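(* Let $X$ be a reflexive Banach space, let $K$ be a nonempty convex closed subset of $X$, let $D\subseteq K$ be a self segment-dense set in $K$ with respect to the weak topology of $X$, and let $F:K\times K\rightrightarrows\mathbb{R}$ be a set-valued map satisfying: (i) for all $y\in D$, the map $x\mapsto F(x,y)$ is weakly lower semicontinuous on $K$; (ii) for all $x\in K$, the map $y\mapsto F(x,y)$ is weakly lower semicontinuous on $K\setminus D$; (iii) for all $x\in K$, the map $y\mapsto F(x,y)$ is convex on $D$; (iv) for all $x\in D$, $F(x,x)\ge 0$; (v) there exists $r>0$ such that for all $x\in K$ with $\|x\|\le r$ there exists $y_0\in D$ with $\|y_0\|<r$ such that $\{0\}\subseteq F(x,y_0)$. Then there exists an element $x_0\in K$ such that $F(x_0,y)\ge 0$ for all $y\in K$.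
   Context: Self segment-dense: for $U\subseteq V\subseteq X$ with $V$ convex and $X$ equipped with a vector topology (here the weak topology), $U$ is self segment-dense in $V$ if $U$ is dense in $V$ (i.e. $V\subseteq\operatorname{cl}(U)$) and for all $x,y\in U$ the set $[x,y]\cap U$ is dense in the closed segment $[x,y]=\{x+t(y-x):t\in[0,1]\}$. Notation: $F(x,y)\ge 0$ means $u\ge 0$ for all $u\in F(x,y)$. Lower semicontinuity: a set-valued map $T:A\rightrightarrows\mathbb{R}$ on a topological space $A$, with domain $D(T)=\{x\in A:T(x)\ne\emptyset\}$, is lower semicontinuous at $x\in D(T)$ if for every open $N\subseteq\mathbb{R}$ with $T(x)\cap N\neq\emptyset$ there is a neighborhood $M$ of $x$ in $A$ such that $T(y)\cap N\ne\emptyset$ for every $y\in M\cap D(T)$. It is lower semicontinuous on $S\subseteq A$ if it is lower semicontinuous at every point of $S$ (so in particular $S\subseteq D(T)$); here $T$ is still regarded as a map on all of $A$. Weakly lower semicontinuous means lower semicontinuous when $A=K$ carries the topology induced by the weak topology of $X$. Convexity on a not necessarily convex set: $T$ is convex on $D$ if for all $x_1,\dots,x_n\in D$ and $\lambda_i\ge0$ with $\sum_{i=1}^n\lambda_i=1$ and $\sum_{i=1}^n\lambda_ix_i\in D$ one has $\sum_{i=1}^n\lambda_iT(x_i)\subseteq T\left(\sum_{i=1}^n\lambda_ix_i\right)$ (Minkowski sum).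
   Formalization: In (v) it is also required that some x in K has norm at most r; otherwise (v) can hold vacuously and the claim fails, e.g. X the real line, K = D = [5,∞), F(x,y) = {x−y}, r = 1. *)

theory Defs
  imports "HOL-Analysis.Analysis"
begin

definition bidual_embedding ::
    "'a::real_normed_vector \<Rightarrow> (('a \<Rightarrow>\<^sub>L real) \<Rightarrow>\<^sub>L real)" where
  "bidual_embedding x = Blinfun (\<lambda>f. blinfun_apply f x)"

lemma bidual_embedding_apply [simp]:
  "blinfun_apply (bidual_embedding x) f = blinfun_apply f x"
  unfolding bidual_embedding_def
  by (simp add: bounded_linear_Blinfun_apply blinfun.bounded_linear_left)

definition reflexive_space :: "'a::real_normed_vector itself \<Rightarrow> bool" where
  "reflexive_space TYPE('a) \<longleftrightarrow>
     surj (bidual_embedding :: 'a \<Rightarrow> (('a \<Rightarrow>\<^sub>L real) \<Rightarrow>\<^sub>L real))"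

definition weak_topology :: "'a::real_normed_vector topology" where
  "weak_topology =
     topology_generated_by {blinfun_apply f -` U | (f :: 'a \<Rightarrow>\<^sub>L real) U. open U}"

lemma topspace_weak_topology [simp]: "topspace weak_topology = UNIV"
proof -
  have "UNIV = blinfun_apply (0 :: 'a \<Rightarrow>\<^sub>L real) -` UNIV" by simp
  then show ?thesis
    unfolding weak_topology_def topology_generated_by_topspace by blast
qed

definition self_segment_dense_in ::
    "'a::real_vector topology \<Rightarrow> 'a set \<Rightarrow> 'a set \<Rightarrow> bool" where
  "self_segment_dense_in X U V \<longleftrightarrow>
     U \<subseteq> V \<and> V \<subseteq> topspace X \<and> convex V \<and>
     V \<subseteq> X closure_of U \<and>
     (\<forall>x\<in>U. \<forall>y\<in>U. closed_segment x y \<subseteq> X closure_of (closed_segment x y \<inter> U))"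

text \<open>A set-valued map on the topological space \<open>A\<close> is given by a function into sets,
  of which only the values on \<open>topspace A\<close> matter.\<close>

definition set_valued_dom :: "'a topology \<Rightarrow> ('a \<Rightarrow> real set) \<Rightarrow> 'a set" where
  "set_valued_dom A T = {x \<in> topspace A. T x \<noteq> {}}"

definition set_valued_lsc_at :: "'a topology \<Rightarrow> ('a \<Rightarrow> real set) \<Rightarrow> 'a \<Rightarrow> bool" where
  "set_valued_lsc_at A T x \<longleftrightarrow>
     x \<in> set_valued_dom A T \<and>
     (\<forall>N. open N \<and> T x \<inter> N \<noteq> {} \<longrightarrow>
        (\<exists>M. openin A M \<and> x \<in> M \<and> (\<forall>y \<in> M \<inter> set_valued_dom A T. T y \<inter> N \<noteq> {})))"

text \<open>The neighbourhoods are those of the whole space \<open>A\<close>, not of the subspace \<open>S\<close>.\<close>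

definition set_valued_lsc_on :: "'a topology \<Rightarrow> ('a \<Rightarrow> real set) \<Rightarrow> 'a set \<Rightarrow> bool" where
  "set_valued_lsc_on A T S \<longleftrightarrow> S \<subseteq> topspace A \<and> (\<forall>x\<in>S. set_valued_lsc_at A T x)"

abbreviation weakly_lsc ::
    "'a::real_normed_vector set \<Rightarrow> ('a \<Rightarrow> real set) \<Rightarrow> 'a set \<Rightarrow> bool" where
  "weakly_lsc K T S \<equiv> set_valued_lsc_on (subtopology weak_topology K) T S"

text \<open>The sum of sets is the Minkowski sum of \<open>HOL-Library.Set_Algebras\<close>, and
  \<open>c *o A\<close> is the dilate of \<open>A\<close> by \<open>c\<close>.  The points \<open>x i\<close> need not be distinct.\<close>

definition set_valued_convex_on :: "'a::real_vector set \<Rightarrow> ('a \<Rightarrow> real set) \<Rightarrow> bool" where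
  "set_valued_convex_on D T \<longleftrightarrow>
     (\<forall>(n::nat) (x :: nat \<Rightarrow> 'a) (l :: nat \<Rightarrow> real).
        (\<forall>i\<in>{1..n}. x i \<in> D \<and> 0 \<le> l i) \<and> (\<Sum>i=1..n. l i) = 1 \<and>
        (\<Sum>i=1..n. l i *\<^sub>R x i) \<in> D
        \<longrightarrow> (\<Sum>i=1..n. l i *o T (x i)) \<subseteq> T (\<Sum>i=1..n. l i *\<^sub>R x i))"

text \<open>A coercivity condition on the points of \<open>K\<close> of norm at most \<open>r\<close> has to presuppose that
  there are such points, else it holds vacuously for a ball that misses \<open>K\<close>.  For
  \<open>K = D = {5..}\<close> in the real line, \<open>F x y = {x - y}\<close> and \<open>r = 1\<close>, all remaining hypotheses
  of the existence theorem hold, but no \<open>x0\<close> in \<open>K\<close> satisfies \<open>x0 - y \<ge> 0\<close> for all \<open>y\<close> in \<open>K\<close>.\<close>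

end

theory Submission
  imports Defs
begin

text \<open>
  Let \<open>K0\<close> be the part of \<open>K\<close> in the closed ball of radius \<open>r\<close>, which is weakly compact, and for
  \<open>y \<in> D \<inter> K0\<close> let \<open>G y\<close> be the set of all \<open>x \<in> K0\<close> with \<open>F x y \<ge> 0\<close>, which is weakly closed by lower
  semicontinuity.  Convexity of \<open>F x\<close> on \<open>D\<close> gives the KKM covering condition at the points of \<open>D\<close>
  in a convex hull of points of \<open>D \<inter> K0\<close>; these are weakly dense in the hull because \<open>D\<close> is self
  segment-dense, and finite unions of the \<open>G y\<close> are closed.  So KKM and compactness provide an \<open>x0\<close>
  with \<open>F x0 y \<ge> 0\<close> for all \<open>y \<in> D \<inter> K0\<close>.  For other \<open>y \<in> D\<close> let \<open>y0\<close> be the point that the coercivity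
  condition assigns to \<open>x0\<close>: near \<open>y0\<close>, the segment from \<open>y0\<close> to \<open>y\<close> contains a point of \<open>D \<inter> K0\<close>
  other than \<open>y0\<close>, and convexity with \<open>0 \<in> F x0 y0\<close> carries nonnegativity from there to \<open>y\<close>.  Lower
  semicontinuity and density extend it to \<open>K - D\<close>.
\<close>

subsection \<open>Hahn--Banach separation\<close>

text \<open>Homogeneity is imposed only as an inequality, the form that infima inherit directly.
  Rescaling by \<open>1 / t\<close> recovers equality for \<open>t > 0\<close>, and
  \<open>t = 0\<close> together with subadditivity gives \<open>q 0 = 0\<close>.\<close>

definition sublinear :: "('a::real_vector \<Rightarrow> real) \<Rightarrow> bool" where
  "sublinear q \<longleftrightarrow> (\<forall>x y. q (x + y) \<le> q x + q y) \<and> (\<forall>t\<ge>0. \<forall>x. q (t *\<^sub>R x) \<le> t * q x)"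

lemma sublinearD:
  assumes "sublinear q"
  shows "q (x + y) \<le> q x + q y" "0 \<le> t \<Longrightarrow> q (t *\<^sub>R x) = t * q x" "- q (- x) \<le> q x"
proof -
  have add: "q (x + y) \<le> q x + q y" and sc: "0 \<le> t \<Longrightarrow> q (t *\<^sub>R x) \<le> t * q x" for x y t
    using assms by (auto simp: sublinear_def)
  show "q (x + y) \<le> q x + q y" by (rule add)
  have z: "q 0 = 0" using add[of 0 0] sc[of 0 0] by simp
  show "0 \<le> t \<Longrightarrow> q (t *\<^sub>R x) = t * q x"
  proof (cases "t = 0")
    case False
    assume "0 \<le> t"
    with False have t: "0 < t" by simp
    have "q x \<le> (1 / t) * q (t *\<^sub>R x)"
      using sc[of "1 / t" "t *\<^sub>R x"] t by simp
    then have "t * q x \<le> q (t *\<^sub>R x)" using t by (simp add: field_simps)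
    with sc[of t x] t show ?thesis by simp
  qed (simp add: z)
  show "- q (- x) \<le> q x" using add[of x "- x"] z by simp
qed

text \<open>The two summands may be minimised separately, because any two indices merge into one
  that does as well for the sum. For a chain of functionals the smaller one merges the pair; for
  families of translates the scalars add up.\<close>

lemma sublinear_INF:
  assumes I: "I \<noteq> {}"
    and bdd: "\<And>x. bdd_below ((\<lambda>i. g i x) ` I)"
    and add: "\<And>i j x y. i \<in> I \<Longrightarrow> j \<in> I \<Longrightarrow> \<exists>k\<in>I. g k (x + y) \<le> g i x + g j y"
    and sc: "\<And>i t x. i \<in> I \<Longrightarrow> 0 \<le> t \<Longrightarrow> \<exists>k\<in>I. g k (t *\<^sub>R x) \<le> t * (g i x :: real)"
  shows "sublinear (\<lambda>x. INF i\<in>I. g i x)"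
proof -
  define u where "u x = (INF i\<in>I. g i x)" for x
  have low: "u x \<le> g i x" if "i \<in> I" for i x
    unfolding u_def using bdd that by (rule cINF_lower)
  have great: "a \<le> u x" if "\<And>i. i \<in> I \<Longrightarrow> a \<le> g i x" for a x
    unfolding u_def using I that by (intro cINF_greatest)
  have 1: "u (x + y) \<le> u x + u y" for x y
  proof -
    have "u (x + y) - g i x \<le> u y" if i: "i \<in> I" for i
    proof (rule great)
      fix j assume "j \<in> I"
      then obtain k where "k \<in> I" "g k (x + y) \<le> g i x + g j y" using add[OF i] by blast
      then show "u (x + y) - g i x \<le> g j y" using low[of k "x + y"] by linarith
    qed
    then have "u (x + y) - u y \<le> u x" by (intro great) (simp add: algebra_simps)
    then show ?thesis by simp
  qed
  have 2: "u (t *\<^sub>R x) \<le> t * u x" if t: "0 \<le> t" for t x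
  proof -
    have *: "u (t *\<^sub>R x) \<le> t * g i x" if i: "i \<in> I" for i
      using sc[OF i t, of x] low[of _ "t *\<^sub>R x"] by (meson order_trans)
    show ?thesis
    proof (cases "t = 0")
      case True
      then show ?thesis using * I by auto
    next
      case False
      with t have "0 < t" by simp
      with * have "u (t *\<^sub>R x) / t \<le> u x" by (intro great) (simp add: field_simps)
      with \<open>0 < t\<close> show ?thesis by (simp add: field_simps)
    qed
  qed
  show ?thesis unfolding sublinear_def using 1 2 unfolding u_def by blast
qed

text \<open>A minimal sublinear functional \<open>q\<close> is linear: \<open>x \<mapsto> inf\<^sub>t (q (x + t y) - t q y)\<close> is a
  sublinear functional below \<open>q\<close>, hence equal to \<open>q\<close>, so that \<open>q x \<le> q (x + y) - q y\<close>.\<close>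

lemma minimal_sublinear_linear:
  assumes q: "sublinear q" and min: "\<And>q'. sublinear q' \<Longrightarrow> q' \<le> q \<Longrightarrow> q' = q"
  shows "linear q"
proof -
  have add: "q (x + y) = q x + q y" for x y
  proof -
    define h where "h t z = q (z + t *\<^sub>R y) - t * q y" for t z
    have lb: "- q (- z) \<le> h t z" if "t \<in> {0..}" for t z
    proof -
      have "t * q y = q (- z + (z + t *\<^sub>R y))" using sublinearD(2)[OF q] that by simp
      also have "\<dots> \<le> q (- z) + q (z + t *\<^sub>R y)" by (rule sublinearD(1)[OF q])
      finally show ?thesis by (simp add: h_def)
    qed
    then have bdd: "bdd_below ((\<lambda>t. h t z) ` {0..})" for z by (rule bdd_belowI2)
    have sub: "sublinear (\<lambda>z. INF t\<in>{0..}. h t z)"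
    proof (rule sublinear_INF[OF _ bdd])
      fix s t :: real and z w assume st: "s \<in> {0..}" "t \<in> {0..}"
      have "h (s + t) (z + w) \<le> h s z + h t w"
        using sublinearD(1)[OF q, of "z + s *\<^sub>R y" "w + t *\<^sub>R y"]
        by (simp add: h_def algebra_simps)
      with st show "\<exists>k\<in>{0..}. h k (z + w) \<le> h s z + h t w" by (intro bexI[of _ "s + t"]) auto
    next
      fix s c :: real and z assume sc: "s \<in> {0..}" "0 \<le> c"
      have "h (c * s) (c *\<^sub>R z) = c * h s z"
        using sublinearD(2)[OF q, of c "z + s *\<^sub>R y"] sc by (simp add: h_def algebra_simps)
      with sc show "\<exists>k\<in>{0..}. h k (c *\<^sub>R z) \<le> c * h s z" by (intro bexI[of _ "c * s"]) auto
    qed auto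
    have low: "(INF t\<in>{0..}. h t z) \<le> h t z" if "0 \<le> t" for t z
      using bdd that by (intro cINF_lower) auto
    have "(\<lambda>z. INF t\<in>{0..}. h t z) \<le> q"
      using low[of 0] by (auto simp: le_fun_def h_def)
    with sub have "(\<lambda>z. INF t\<in>{0..}. h t z) = q" by (rule min)
    then have "q x \<le> h 1 x" using low[of 1 x] by (metis zero_le_one)
    then show ?thesis using sublinearD(1)[OF q, of x y] by (simp add: h_def)
  qed
  have q0: "q 0 = 0" using add[of 0 0] by simp
  have neg: "q (- x) = - q x" for x using add[of x "- x"] q0 by simp
  have "q (t *\<^sub>R x) = t * q x" for t x
  proof (cases "0 \<le> t")
    case True
    then show ?thesis by (rule sublinearD(2)[OF q])
  next
    case False
    then have "q ((- t) *\<^sub>R x) = (- t) * q x" by (intro sublinearD(2)[OF q]) simp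
    then show ?thesis using neg[of "t *\<^sub>R x"] by simp
  qed
  with add show ?thesis by (intro linearI) auto
qed

text \<open>Zorn's lemma for the reversed order yields a minimal sublinear functional below
  \<open>p\<close>, which is linear. A nonempty chain is bounded by its pointwise infimum, finite
  because \<open>- p (- x) \<le> - q (- x) \<le> q x\<close>.\<close>

theorem sublinear_dominates_linear:
  assumes p: "sublinear p"
  obtains f where "linear f" "\<And>x. f x \<le> p x"
proof -
  define A where "A = {q. sublinear q \<and> q \<le> p}"
  have po: "partial_order_on A (relation_of (\<lambda>a b. b \<le> a) A)"
    by (auto simp: partial_order_on_def preorder_on_def refl_on_def trans_def antisym_def
        relation_of_def)
  have "\<exists>u\<in>A. \<forall>a\<in>C. u \<le> a" if C: "C \<in> Chains (relation_of (\<lambda>a b. b \<le> a) A)" for C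
  proof (cases "C = {}")
    case True
    then show ?thesis using p by (auto simp: A_def)
  next
    case False
    have CA: "q \<in> A" if "q \<in> C" for q using C that by (auto simp: Chains_def relation_of_def)
    have chain: "a \<le> b \<or> b \<le> a" if "a \<in> C" "b \<in> C" for a b
      using C that by (auto simp: Chains_def relation_of_def)
    have bdd: "bdd_below ((\<lambda>q. q x) ` C)" for x
    proof (rule bdd_belowI2)
      fix q assume "q \<in> C"
      then have "sublinear q" "q (- x) \<le> p (- x)" using CA by (auto simp: A_def le_fun_def)
      then show "- p (- x) \<le> q x" using sublinearD(3)[of q x] by linarith
    qed
    have "sublinear (\<lambda>x. INF q\<in>C. q x)"
    proof (rule sublinear_INF[OF False bdd])
      fix a b x y assume ab: "a \<in> C" "b \<in> C"
      then have "sublinear a" "sublinear b" using CA by (auto simp: A_def)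
      note s = sublinearD(1)[OF this(1), of x y] sublinearD(1)[OF this(2), of x y]
      show "\<exists>k\<in>C. k (x + y) \<le> a x + b y"
        using chain[OF ab]
      proof
        assume "a \<le> b"
        then have "a y \<le> b y" by (simp add: le_fun_def)
        with s ab show ?thesis by (intro bexI[of _ a]) auto
      next
        assume "b \<le> a"
        then have "b x \<le> a x" by (simp add: le_fun_def)
        with s ab show ?thesis by (intro bexI[of _ b]) auto
      qed
    next
      fix a t x assume "a \<in> C" "0 \<le> (t::real)"
      then show "\<exists>k\<in>C. k (t *\<^sub>R x) \<le> t * a x"
        using CA by (auto simp: A_def sublinear_def)
    qed
    moreover have low: "(\<lambda>x. INF q\<in>C. q x) \<le> q" if "q \<in> C" for q
      using bdd that by (auto simp: le_fun_def intro: cINF_lower)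
    moreover have "(\<lambda>x. INF q\<in>C. q x) \<le> p"
    proof -
      obtain q where "q \<in> C" using False by blast
      with low CA show ?thesis unfolding A_def by (blast intro: order_trans)
    qed
    ultimately show ?thesis unfolding A_def by blast
  qed
  from predicate_Zorn[OF po this] obtain m
    where m: "m \<in> A" and min: "\<forall>a\<in>A. a \<le> m \<longrightarrow> a = m" by blast
  have "linear m"
    using m min by (intro minimal_sublinear_linear) (auto simp: A_def intro: order_trans)
  with m show ?thesis by (intro that[of m]) (auto simp: A_def le_fun_def)
qed

text \<open>The linear functional is taken below \<open>p z = inf (norm (z + t (c - x)) - t d)\<close>, the infimum
  over \<open>t \<ge> 0\<close> and \<open>c \<in> C\<close>: the term \<open>t = 0\<close> bounds it by the norm, and \<open>t = 1\<close> gives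
  \<open>p (x - c) \<le> - d\<close>.\<close>

theorem separating_functional_closed_point:
  fixes C :: "'a::real_normed_vector set"
  assumes "convex C" "closed C" "x \<notin> C"
  shows "\<exists>(f :: 'a \<Rightarrow>\<^sub>L real) d. 0 < d \<and> (\<forall>c\<in>C. f x + d \<le> f c)"
proof (cases "C = {}")
  case True
  then show ?thesis by (auto intro: exI[of _ 1])
next
  case False
  obtain d where d: "0 < d" "ball x d \<subseteq> - C"
    using assms open_contains_ball[of "- C"] by auto
  have far: "d \<le> norm (c - x)" if "c \<in> C" for c
  proof -
    have "c \<notin> ball x d" using that d by blast
    then show ?thesis by (simp add: dist_norm norm_minus_commute)
  qed
  define I where "I = {0::real..} \<times> C"
  define g where "g = (\<lambda>(t, c) z. norm (z + t *\<^sub>R (c - x)) - t * d)"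
  have lb: "- norm z \<le> g i z" if i: "i \<in> I" for i z
  proof -
    obtain t c where tc: "i = (t, c)" "0 \<le> t" "c \<in> C" using i by (auto simp: I_def)
    have "t * d \<le> t * norm (c - x)" using tc far by (simp add: mult_left_mono)
    also have "\<dots> = norm ((z + t *\<^sub>R (c - x)) - z)" using tc by simp
    also have "\<dots> \<le> norm (z + t *\<^sub>R (c - x)) + norm z" by (rule norm_triangle_ineq4)
    finally show ?thesis by (simp add: g_def tc)
  qed
  have bdd: "bdd_below ((\<lambda>i. g i z) ` I)" for z using lb by (rule bdd_belowI2)
  define p where "p z = (INF i\<in>I. g i z)" for z
  have low: "p z \<le> g i z" if "i \<in> I" for i z
    unfolding p_def using bdd that by (rule cINF_lower)
  have "sublinear p"
    unfolding p_def
  proof (rule sublinear_INF[OF _ bdd])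
    show "I \<noteq> {}" using False by (auto simp: I_def)
  next
    fix i j z w assume "i \<in> I" "j \<in> I"
    then obtain s a t b where ij: "i = (s, a)" "j = (t, b)" "0 \<le> s" "0 \<le> t" "a \<in> C" "b \<in> C"
      by (auto simp: I_def)
    \<comment> \<open>The cone generated by \<open>C - x\<close> is closed under addition:
      \<open>c\<close> is the mean of \<open>a\<close> and \<open>b\<close> with weights
      proportional to \<open>s\<close> and \<open>t\<close>.\<close>
    have "\<exists>c\<in>C. (s + t) *\<^sub>R (c - x) = s *\<^sub>R (a - x) + t *\<^sub>R (b - x)"
    proof (cases "s + t = 0")
      case True
      then have "s = 0" "t = 0" using ij by auto
      then show ?thesis using ij by auto
    next
      case nz: False
      let ?c = "(s / (s + t)) *\<^sub>R a + (t / (s + t)) *\<^sub>R b"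
      have "?c \<in> C"
        using nz ij by (intro convexD[OF assms(1)]) (auto simp: add_divide_distrib[symmetric])
      moreover have "(s + t) *\<^sub>R ?c = s *\<^sub>R a + t *\<^sub>R b"
        using nz by (simp add: scaleR_add_right)
      then have "(s + t) *\<^sub>R (?c - x) = s *\<^sub>R (a - x) + t *\<^sub>R (b - x)"
        by (simp add: algebra_simps)
      ultimately show ?thesis by blast
    qed
    then obtain c where c: "c \<in> C" "(s + t) *\<^sub>R (c - x) = s *\<^sub>R (a - x) + t *\<^sub>R (b - x)" by blast
    have "g (s + t, c) (z + w) \<le> g i z + g j w"
      using norm_triangle_ineq[of "z + s *\<^sub>R (a - x)" "w + t *\<^sub>R (b - x)"] c(2)
      by (simp add: g_def ij algebra_simps)
    then show "\<exists>k\<in>I. g k (z + w) \<le> g i z + g j w"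
      using ij c by (intro bexI[of _ "(s + t, c)"]) (auto simp: I_def)
  next
    fix i t z assume "i \<in> I" and t: "0 \<le> (t::real)"
    then obtain s a where i: "i = (s, a)" "0 \<le> s" "a \<in> C" by (auto simp: I_def)
    have "t *\<^sub>R z + (t * s) *\<^sub>R (a - x) = t *\<^sub>R (z + s *\<^sub>R (a - x))"
      by (simp add: algebra_simps)
    then have "norm (t *\<^sub>R z + (t * s) *\<^sub>R (a - x)) = t * norm (z + s *\<^sub>R (a - x))"
      using t by simp
    then have "g (t * s, a) (t *\<^sub>R z) = t * g i z"
      by (simp add: g_def i right_diff_distrib)
    then show "\<exists>k\<in>I. g k (t *\<^sub>R z) \<le> t * g i z"
      using i t by (intro bexI[of _ "(t * s, a)"]) (auto simp: I_def)
  qed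
  then obtain f where f: "linear f" "\<And>z. f z \<le> p z" using sublinear_dominates_linear by blast
  obtain c0 where c0: "c0 \<in> C" using False by blast
  have le: "f z \<le> norm z" for z
    using f(2)[of z] low[of "(0, c0)" z] c0 by (simp add: I_def g_def)
  have "\<bar>f z\<bar> \<le> norm z" for z
    using le[of z] le[of "- z"] linear_neg[OF f(1), of z] by simp
  then have bl: "bounded_linear f"
    using f(1) by (intro bounded_linear_intro[of f 1])
      (auto simp: linear_add linear_cmul)
  have "f x + d \<le> f c" if c: "c \<in> C" for c
  proof -
    have "f (x - c) \<le> - d"
      using f(2)[of "x - c"] low[of "(1, c)" "x - c"] c by (simp add: I_def g_def)
    then show ?thesis using linear_diff[OF f(1)] by simp
  qed
  then show ?thesis
    using d(1) by (intro exI[of _ "Blinfun f"] exI[of _ d])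
      (simp add: bounded_linear_Blinfun_apply[OF bl])
qed

subsection \<open>Weak compactness in reflexive spaces\<close>

lemma openin_weak_topology_vimage:
  fixes f :: "'a::real_normed_vector \<Rightarrow>\<^sub>L real"
  shows "open U \<Longrightarrow> openin weak_topology (blinfun_apply f -` U)"
  unfolding weak_topology_def by (rule topology_generated_by_Basis) blast

text \<open>Universal property of an initial topology: it is enough to check preimages of subbasic
  sets.\<close>

lemma continuous_map_into_weak_topology:
  fixes g :: "'b \<Rightarrow> 'a::real_normed_vector"
  assumes "\<And>f :: 'a \<Rightarrow>\<^sub>L real. continuous_map X euclideanreal (\<lambda>x. f (g x))"
  shows "continuous_map X weak_topology g"
  unfolding weak_topology_def
proof (rule continuous_on_generated_topo)
  fix W assume "W \<in> {blinfun_apply f -` U | (f :: 'a \<Rightarrow>\<^sub>L real) U. open U}"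
  then obtain f :: "'a \<Rightarrow>\<^sub>L real" and U where W: "W = blinfun_apply f -` U" "open U" by blast
  have "g -` W \<inter> topspace X = {x \<in> topspace X. f (g x) \<in> U}" using W by auto
  then show "openin X (g -` W \<inter> topspace X)"
    using openin_continuous_map_preimage[OF assms, of U f] W by simp
next
  show "g ` topspace X \<subseteq> \<Union> {blinfun_apply f -` U | (f :: 'a \<Rightarrow>\<^sub>L real) U. open U}"
    using topspace_weak_topology[where 'a = 'a]
    unfolding weak_topology_def topology_generated_by_topspace by blast
qed

lemma continuous_map_weak_topology_blinfun:
  fixes f :: "'a::real_normed_vector \<Rightarrow>\<^sub>L real"
  shows "continuous_map weak_topology euclideanreal f"
  using openin_weak_topology_vimage[of _ f]
  by (auto simp: continuous_map_def vimage_def)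

text \<open>Needed because lower semicontinuity yields weakly closed sets while KKM asks for
  norm-closed ones. The identity is norm-to-weak continuous since every functional is norm
  continuous.\<close>

lemma closedin_weak_topology_imp_closed:
  assumes "closedin weak_topology C"
  shows "closed C"
proof -
  have "continuous_map euclidean weak_topology (\<lambda>x::'a. x)"
    by (rule continuous_map_into_weak_topology)
      (simp add: linear_continuous_on blinfun.bounded_linear_right)
  from closedin_continuous_map_preimage[OF this assms] show ?thesis by simp
qed

text \<open>Mazur's theorem: for \<open>x\<close> outside \<open>C\<close>, a separating functional
  provides a weakly open half-space around \<open>x\<close> that misses \<open>C\<close>.\<close>

lemma closedin_weak_topology_convex:
  assumes "convex C" "closed C"
  shows "closedin weak_topology C"
proof -
  have "\<exists>T. openin weak_topology T \<and> x \<in> T \<and> T \<subseteq> - C" if x: "x \<notin> C" for x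
  proof -
    obtain f :: "'a \<Rightarrow>\<^sub>L real" and d where d: "0 < d" "\<forall>c\<in>C. f x + d \<le> f c"
      using separating_functional_closed_point[OF assms x] by blast
    show ?thesis
      using openin_weak_topology_vimage[of "{..<f x + d}" f] d
      by (intro exI[of _ "f -` {..<f x + d}"]) force
  qed
  then have "openin weak_topology (- C)"
    by (subst openin_subopen) blast
  then show ?thesis by (simp add: closedin_def Compl_eq_Diff_UNIV)
qed

text \<open>Tychonoff: by reflexivity, the linear elements of the product of the intervals
  \<open>{- r * norm f..r * norm f}\<close> are exactly the evaluations at the points of the set below.\<close>

lemma compactin_weak_topology_polar:
  assumes refl: "reflexive_space TYPE('a::real_normed_vector)"
  shows "compactin weak_topology {x::'a. \<forall>f :: 'a \<Rightarrow>\<^sub>L real. \<bar>blinfun_apply f x\<bar> \<le> r * norm f}"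
proof -
  let ?J = "\<lambda>f :: 'a \<Rightarrow>\<^sub>L real. {- r * norm f..r * norm f}"
  define Lin where "Lin = {\<phi> :: ('a \<Rightarrow>\<^sub>L real) \<Rightarrow> real.
    (\<forall>f g. \<phi> (f + g) = \<phi> f + \<phi> g) \<and> (\<forall>c f. \<phi> (c *\<^sub>R f) = c * \<phi> f)}"
  define L where "L = PiE UNIV ?J \<inter> Lin"
  have "compactin (product_topology (\<lambda>_. euclideanreal) UNIV) (PiE UNIV ?J)"
    by (simp add: compactin_PiE)
  then have "compact (PiE UNIV ?J)"
    by (simp only: euclidean_product_topology compactin_euclidean_iff)
  moreover have "closed Lin"
  proof -
    have c: "continuous_on UNIV (\<lambda>\<phi> :: ('a \<Rightarrow>\<^sub>L real) \<Rightarrow> real. \<phi> f)" for f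
      by (rule continuous_on_product_coordinates)
    show ?thesis
      unfolding Lin_def
      by (intro closed_Collect_conj closed_Collect_all closed_Collect_eq
          continuous_on_add[OF c c] continuous_on_mult_left[OF c] c)
  qed
  ultimately have L: "compact L" unfolding L_def by (rule compact_Int_closed)
  have ev: "\<exists>x. \<forall>f. \<phi> f = blinfun_apply f x" if "\<phi> \<in> L" for \<phi>
  proof -
    have lin: "\<phi> (f + g) = \<phi> f + \<phi> g" "\<phi> (c *\<^sub>R f) = c * \<phi> f" for f g c
      using that by (auto simp: L_def Lin_def)
    have bd: "\<phi> f \<in> ?J f" for f using that by (simp add: L_def PiE_iff)
    have "\<bar>\<phi> f\<bar> \<le> norm f * r" for f 
      using bd[of f] by (simp add: mult.commute abs_le_iff)
    then have bl: "bounded_linear \<phi>" using lin by (intro bounded_linear_intro[of _ r]) auto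
    obtain x where "Blinfun \<phi> = bidual_embedding x"
      using refl unfolding reflexive_space_def by (meson surjD)
    then have "blinfun_apply (Blinfun \<phi>) f = blinfun_apply f x" for f by simp
    then show ?thesis using bounded_linear_Blinfun_apply[OF bl] by auto
  qed
  define g where "g \<phi> = (SOME x. \<forall>f. \<phi> f = blinfun_apply f x)" for \<phi> :: "('a \<Rightarrow>\<^sub>L real) \<Rightarrow> real"
  have g: "blinfun_apply f (g \<phi>) = \<phi> f" if "\<phi> \<in> L" for \<phi> f
    unfolding g_def by (rule spec[OF someI_ex[OF ev[OF that]], symmetric])
  \<comment> \<open>Only the maps sending \<open>\<phi>\<close> to \<open>f (g \<phi>)\<close>
    matter, and on \<open>L\<close> these are the coordinate projections.\<close>
  have "continuous_map (top_of_set L) weak_topology g"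
  proof (rule continuous_map_into_weak_topology)
    fix f :: "'a \<Rightarrow>\<^sub>L real"
    have "continuous_on L (\<lambda>\<phi>. \<phi> f)"
      using continuous_on_product_coordinates by (rule continuous_on_subset) simp
    then have "continuous_on L (\<lambda>\<phi>. f (g \<phi>))"
      by (rule continuous_on_eq) (simp add: g)
    then show "continuous_map (top_of_set L) euclideanreal (\<lambda>\<phi>. f (g \<phi>))" by simp
  qed
  then have comp: "compactin weak_topology (g ` L)"
    by (rule image_compactin[rotated]) (simp add: compactin_subtopology L)
  have sub: "{x. \<forall>f :: 'a \<Rightarrow>\<^sub>L real. \<bar>blinfun_apply f x\<bar> \<le> r * norm f} \<subseteq> g ` L"
  proof
    fix x :: 'a assume x: "x \<in> {x. \<forall>f :: 'a \<Rightarrow>\<^sub>L real. \<bar>blinfun_apply f x\<bar> \<le> r * norm f}"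
    define \<phi> where "\<phi> f = blinfun_apply f x" for f :: "'a \<Rightarrow>\<^sub>L real"
    have "\<phi> \<in> L"
    proof -
      have "\<phi> f \<in> ?J f" for f
        using x by (auto simp: \<phi>_def abs_le_iff dest: spec[of _ f])
      then show ?thesis
        by (simp add: L_def Lin_def \<phi>_def PiE_iff blinfun.add_left blinfun.scaleR_left)
    qed
    \<comment> \<open>Functionals separate points, whereas all of them agree at
      \<open>g \<phi>\<close> and \<open>x\<close>.\<close>
    have "g \<phi> = x"
    proof (rule ccontr)
      assume "g \<phi> \<noteq> x"
      then obtain f :: "'a \<Rightarrow>\<^sub>L real" and d where "0 < d" "f (g \<phi>) + d \<le> f x"
        using separating_functional_closed_point[of "{x}" "g \<phi>"]
        by auto
      then show False using g[OF \<open>\<phi> \<in> L\<close>, of f] by (simp add: \<phi>_def)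
    qed
    with \<open>\<phi> \<in> L\<close> show "x \<in> g ` L" by blast
  qed
  moreover have "closedin weak_topology {x. \<forall>f :: 'a \<Rightarrow>\<^sub>L real. \<bar>blinfun_apply f x\<bar> \<le> r * norm f}"
  proof (rule closedin_weak_topology_convex)
    have P: "{x. \<forall>f :: 'a \<Rightarrow>\<^sub>L real. \<bar>blinfun_apply f x\<bar> \<le> r * norm f}
        = (\<Inter>f :: 'a \<Rightarrow>\<^sub>L real. blinfun_apply f -` {- (r * norm f)..r * norm f})"
    proof -
      have "\<bar>a\<bar> \<le> b \<longleftrightarrow> - b \<le> a \<and> a \<le> b" for a b :: real by linarith
      then show ?thesis by (simp add: set_eq_iff)
    qed
    have "closed (blinfun_apply f -` {- (r * norm f)..r * norm f})" for f :: "'a \<Rightarrow>\<^sub>L real"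
      by (rule continuous_closed_vimage)
        (simp_all add: linear_continuous_at blinfun.bounded_linear_right)
    then show "closed {x. \<forall>f :: 'a \<Rightarrow>\<^sub>L real. \<bar>blinfun_apply f x\<bar> \<le> r * norm f}"
      unfolding P by blast
    have "convex (blinfun_apply f -` {- (r * norm f)..r * norm f})" for f :: "'a \<Rightarrow>\<^sub>L real"
      by (rule convex_linear_vimage)
        (simp_all add: bounded_linear.linear blinfun.bounded_linear_right)
    then show "convex {x. \<forall>f :: 'a \<Rightarrow>\<^sub>L real. \<bar>blinfun_apply f x\<bar> \<le> r * norm f}"
      unfolding P by (rule convex_INT)
  qed
  ultimately show ?thesis using closed_compactin[OF comp] by blast
qed

theorem compactin_weak_topology_bounded_convex:
  fixes C :: "'a::real_normed_vector set"
  assumes "reflexive_space TYPE('a)" "convex C" "closed C" "bounded C"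
  shows "compactin weak_topology C"
proof -
  obtain r where r: "\<forall>x\<in>C. norm x \<le> r" using assms(4) unfolding bounded_iff by blast
  have "\<bar>blinfun_apply f x\<bar> \<le> r * norm f" if "x \<in> C" for x and f :: "'a \<Rightarrow>\<^sub>L real"
  proof -
    have "\<bar>f x\<bar> \<le> norm f * norm x" using norm_blinfun[of f x] by simp
    also have "\<dots> \<le> norm f * r" using r that by (simp add: mult_left_mono)
    finally show ?thesis by (simp add: mult.commute)
  qed
  then have "C \<subseteq> {x. \<forall>f :: 'a \<Rightarrow>\<^sub>L real. \<bar>blinfun_apply f x\<bar> \<le> r * norm f}" by blast
  then show ?thesis
    by (rule closed_compactin[OF compactin_weak_topology_polar[OF assms(1)] _
          closedin_weak_topology_convex[OF assms(2,3)]])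
qed

subsection \<open>The theorems of Brouwer and KKM\<close>

text \<open>Fixing the coordinates from \<open>n\<close> on at 0 places cubes of every dimension in
  one function space with the product topology, so that \<open>n\<close> can be a term.\<close>

definition unit_cube :: "nat \<Rightarrow> (nat \<Rightarrow> real) set" where
  "unit_cube n = {x. (\<forall>i<n. 0 \<le> x i \<and> x i \<le> 1) \<and> (\<forall>i\<ge>n. x i = 0)}"

lemma compact_unit_cube: "compact (unit_cube n)"
proof -
  define J where "J i = (if i < n then {0..1} else {0::real})" for i
  have "compactin (product_topology (\<lambda>_. euclideanreal) UNIV) (PiE UNIV J)"
    by (simp add: compactin_PiE J_def)
  then have "compact (PiE UNIV J)"
    by (simp only: euclidean_product_topology compactin_euclidean_iff)
  moreover have "PiE UNIV J = unit_cube n"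
    by (auto simp: unit_cube_def J_def PiE_iff split: if_splits)
  ultimately show ?thesis by simp
qed

lemma tendsto_fun_iff:
  fixes f :: "'c \<Rightarrow> 'i \<Rightarrow> 'b::topological_space"
  shows "(f \<longlongrightarrow> l) F \<longleftrightarrow> (\<forall>i. ((\<lambda>c. f c i) \<longlongrightarrow> l i) F)"
  using limitin_componentwise[of "\<lambda>_. euclidean" UNIV f l F]
  by (simp add: euclidean_product_topology)

text \<open>The library proves Brouwer's theorem for Euclidean space types; for a dimension that is a
  term, it is derived here from the combinatorial lemma of Kuhn.\<close>

theorem brouwer_unit_cube:
  assumes cont: "\<And>i. i < n \<Longrightarrow> continuous_on (unit_cube n) (\<lambda>x. f x i)"
    and bounds: "\<And>x i. x \<in> unit_cube n \<Longrightarrow> i < n \<Longrightarrow> 0 \<le> f x i \<and> f x i \<le> 1"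
  shows "\<exists>x\<in>unit_cube n. \<forall>i<n. f x i = x i"
proof -
  define grid where "grid p v i = (if i < n then real (v i) / real p else 0)"
    for p i :: nat and v :: "nat \<Rightarrow> nat"
  have grid: "grid p v \<in> unit_cube n" if "0 < p" "\<forall>j<n. v j \<le> p" for p v
    using that by (auto simp: unit_cube_def grid_def)
  \<comment> \<open>Label 0 says that \<open>f\<close> does not decrease coordinate
    \<open>i\<close>. Kuhn's lemma demands label 1 on the face \<open>v i = p\<close>; this is
    harmless, since there the coordinate is 1 and \<open>f\<close> is at most 1. On the face
    \<open>v i = 0\<close>, label 0 follows from \<open>f\<close> being nonnegative.\<close>
  define label where
    "label p v i = (if v i = p \<or> f (grid p v) i < grid p v i then 1 else 0::nat)" for p v i
  have "\<exists>q. (\<forall>i<n. q i < p) \<and>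
    (\<forall>i<n. \<exists>r s. (\<forall>j<n. q j \<le> r j \<and> r j \<le> q j + 1) \<and> (\<forall>j<n. q j \<le> s j \<and> s j \<le> q j + 1)
       \<and> label p r i \<noteq> label p s i)" if p: "0 < p" for p
  proof -
    have l01: "\<forall>v. (\<forall>i<n. v i \<le> p) \<longrightarrow> (\<forall>i<n. label p v i = 0 \<or> label p v i = 1)"
      and lp: "\<forall>v. (\<forall>i<n. v i \<le> p) \<longrightarrow> (\<forall>i<n. v i = p \<longrightarrow> label p v i = 1)"
      by (simp_all add: label_def)
    have l0: "\<forall>v. (\<forall>i<n. v i \<le> p) \<longrightarrow> (\<forall>i<n. v i = 0 \<longrightarrow> label p v i = 0)"
    proof (intro allI impI)
      fix v i assume v: "\<forall>i<n. v i \<le> p" "i < n" "v i = 0"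
      then show "label p v i = 0"
        using bounds[OF grid[OF p v(1)] v(2)] p by (simp add: label_def grid_def)
    qed
    show ?thesis by (rule kuhn_lemma[OF p l01 l0 lp]) blast
  qed
  then have "\<forall>k. \<exists>q. (\<forall>i<n. q i < Suc k) \<and>
    (\<forall>i<n. \<exists>r s. (\<forall>j<n. q j \<le> r j \<and> r j \<le> q j + 1) \<and> (\<forall>j<n. q j \<le> s j \<and> s j \<le> q j + 1)
       \<and> label (Suc k) r i \<noteq> label (Suc k) s i)" by blast
  from choice[OF this] obtain q where Q: "\<forall>k. (\<forall>i<n. q k i < Suc k) \<and>
    (\<forall>i<n. \<exists>r s. (\<forall>j<n. q k j \<le> r j \<and> r j \<le> q k j + 1) \<and>
        (\<forall>j<n. q k j \<le> s j \<and> s j \<le> q k j + 1) \<and> label (Suc k) r i \<noteq> label (Suc k) s i)" ..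
  then have q: "q k i < Suc k" if "i < n" for k i using that by blast
  have gridq: "\<forall>k. grid (Suc k) (q k) \<in> unit_cube n"
    using q by (intro allI grid) (auto intro: less_imp_le)
  obtain x m where x: "x \<in> unit_cube n" and m: "strict_mono (m :: nat \<Rightarrow> nat)"
    and lim': "((\<lambda>k. grid (Suc k) (q k)) \<circ> m) \<longlonglongrightarrow> x"
    by (rule seq_compactE[OF compact_imp_seq_compact[OF compact_unit_cube] gridq])
  from lim' have lim: "(\<lambda>k. grid (Suc (m k)) (q (m k))) \<longlonglongrightarrow> x" by (simp add: o_def)
  \<comment> \<open>Every corner of the cell at \<open>q (m k)\<close> differs from its base point
    by at most the mesh width in each coordinate, so any choice of corners has the same
    limit.\<close>
  have near: "(\<lambda>k. grid (Suc (m k)) (w k)) \<longlonglongrightarrow> x"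
    if w: "\<And>k j. j < n \<Longrightarrow> q (m k) j \<le> w k j \<and> w k j \<le> q (m k) j + 1" for w
    unfolding tendsto_fun_iff
  proof
    fix j
    have null: "(\<lambda>k. 1 / real (Suc (m k))) \<longlonglongrightarrow> 0"
      using LIMSEQ_subseq_LIMSEQ[OF lim_1_over_n[where 'a = real, THEN LIMSEQ_Suc] m]
      by (simp add: o_def)
    have "norm (grid (Suc (m k)) (w k) j - grid (Suc (m k)) (q (m k)) j)
        \<le> 1 / real (Suc (m k))" for k
    proof (cases "j < n")
      case True
      then have "grid (Suc (m k)) (w k) j - grid (Suc (m k)) (q (m k)) j
          = real (w k j - q (m k) j) / real (Suc (m k))"
        using w[of j k] by (simp add: grid_def diff_divide_distrib of_nat_diff)
      moreover have "real (w k j - q (m k) j) \<le> 1" using w[OF True, of k] by linarith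
      ultimately show ?thesis by (simp add: divide_right_mono del: of_nat_Suc)
    qed (simp add: grid_def)
    then have diff: "(\<lambda>k. grid (Suc (m k)) (w k) j - grid (Suc (m k)) (q (m k)) j) \<longlonglongrightarrow> 0"
      by (rule Lim_null_comparison[OF always_eventually[OF allI] null])
    have "(\<lambda>k. grid (Suc (m k)) (q (m k)) j) \<longlonglongrightarrow> x j"
      using lim unfolding tendsto_fun_iff by blast
    from tendsto_add[OF diff this]
    show "(\<lambda>k. grid (Suc (m k)) (w k) j) \<longlonglongrightarrow> x j" by simp
  qed
  have "f x i = x i" if i: "i < n" for i
  proof -
    \<comment> \<open>Two corners of the cell carry different labels, hence both labels occur. In
      the limit, corners labelled 0 give \<open>x i \<le> f x i\<close> and corners labelled 1 the
      converse.\<close>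
    have ab: "\<exists>v. (\<forall>j<n. q k j \<le> v j \<and> v j \<le> q k j + 1) \<and> label (Suc k) v i = c"
      if c: "c = 0 \<or> c = 1" for k c
    proof -
      obtain r s where "\<forall>j<n. q k j \<le> r j \<and> r j \<le> q k j + 1"
        "\<forall>j<n. q k j \<le> s j \<and> s j \<le> q k j + 1" "label (Suc k) r i \<noteq> label (Suc k) s i"
        using Q i by blast
      moreover from this(3) have "label (Suc k) r i = c \<or> label (Suc k) s i = c"
        using c by (auto simp: label_def split: if_splits)
      ultimately show ?thesis by blast
    qed
    have "\<forall>k. \<exists>v. (\<forall>j<n. q k j \<le> v j \<and> v j \<le> q k j + 1) \<and> label (Suc k) v i = 0"
      using ab by simp
    from choice[OF this] obtain a
      where a: "\<And>k j. j < n \<Longrightarrow> q k j \<le> a k j \<and> a k j \<le> q k j + 1" "\<And>k. label (Suc k) (a k) i = 0"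
      by blast
    have "\<forall>k. \<exists>v. (\<forall>j<n. q k j \<le> v j \<and> v j \<le> q k j + 1) \<and> label (Suc k) v i = 1"
      using ab by simp
    from choice[OF this] obtain b
      where b: "\<And>k j. j < n \<Longrightarrow> q k j \<le> b k j \<and> b k j \<le> q k j + 1" "\<And>k. label (Suc k) (b k) i = 1"
      by blast
    have fw: "(\<lambda>k. f (grid (Suc (m k)) (w k)) i) \<longlonglongrightarrow> f x i"
      "(\<lambda>k. grid (Suc (m k)) (w k) i) \<longlonglongrightarrow> x i"
      "\<And>k. grid (Suc (m k)) (w k) \<in> unit_cube n"
      if w: "\<And>k j. j < n \<Longrightarrow> q (m k) j \<le> w k j \<and> w k j \<le> q (m k) j + 1" for w
    proof -
      have *: "w k j \<le> Suc (m k)" if "j < n" for j k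
        using w[OF that, of k] q[OF that, of "m k"] by linarith
      show cube: "\<And>k. grid (Suc (m k)) (w k) \<in> unit_cube n" by (intro grid) (auto intro: *)
      show "(\<lambda>k. grid (Suc (m k)) (w k) i) \<longlonglongrightarrow> x i" 
        using near[of w] w unfolding tendsto_fun_iff by blast
      show "(\<lambda>k. f (grid (Suc (m k)) (w k)) i) \<longlonglongrightarrow> f x i"
        using cube by (intro continuous_on_tendsto_compose[OF cont[OF i] near[of w] x] w) auto
    qed
    have "x i \<le> f x i"
    proof (rule LIMSEQ_le)
      show "(\<lambda>k. grid (Suc (m k)) (a (m k)) i) \<longlonglongrightarrow> x i"
        "(\<lambda>k. f (grid (Suc (m k)) (a (m k))) i) \<longlonglongrightarrow> f x i"
        using fw[of "\<lambda>k. a (m k)"] a(1) by blast+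
      have "grid (Suc (m k)) (a (m k)) i \<le> f (grid (Suc (m k)) (a (m k))) i" for k
        using a(2)[of "m k"] by (simp add: label_def split: if_splits)
      then show "\<exists>N. \<forall>k\<ge>N. grid (Suc (m k)) (a (m k)) i \<le> f (grid (Suc (m k)) (a (m k))) i"
        by blast
    qed
    moreover have "f x i \<le> x i"
    proof (rule LIMSEQ_le)
      show "(\<lambda>k. grid (Suc (m k)) (b (m k)) i) \<longlonglongrightarrow> x i"
        "(\<lambda>k. f (grid (Suc (m k)) (b (m k))) i) \<longlonglongrightarrow> f x i"
        using fw[of "\<lambda>k. b (m k)"] b(1) by blast+
      have "f (grid (Suc (m k)) (b (m k))) i \<le> grid (Suc (m k)) (b (m k)) i" for k
      proof (cases "b (m k) i = Suc (m k)")
        case True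
        then have "grid (Suc (m k)) (b (m k)) i = 1" using i by (simp add: grid_def)
        then show ?thesis using bounds[OF fw(3)[of "\<lambda>k. b (m k)"] i] b(1) by simp
      next
        case False
        then show ?thesis using b(2)[of "m k"] by (simp add: label_def split: if_splits)
      qed
      then show "\<exists>N. \<forall>k\<ge>N. f (grid (Suc (m k)) (b (m k))) i \<le> grid (Suc (m k)) (b (m k)) i"
        by blast
    qed
    ultimately show ?thesis by simp
  qed
  with x show ?thesis by blast
qed

text \<open>KKM by way of Brouwer: a point of the simplex is moved to the one whose barycentric
  coordinates are proportional to its distances from the sets \<open>C i\<close>.  The simplex is the corner
  \<open>\<Sum>i<n. t i \<le> 1\<close> of the cube, onto which \<open>t \<mapsto> t / max 1 (\<Sum>i<n. t i)\<close> retracts.\<close>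

theorem KKM:
  fixes y :: "nat \<Rightarrow> 'a::real_normed_vector"
  assumes closed: "\<And>i. i \<le> n \<Longrightarrow> closed (C i)"
    and cover: "\<And>I. I \<subseteq> {..n} \<Longrightarrow> convex hull (y ` I) \<subseteq> (\<Union>i\<in>I. C i)"
  shows "\<exists>x \<in> convex hull (y ` {..n}). \<forall>i\<le>n. x \<in> C i"
proof (rule ccontr)
  assume "\<not> ?thesis"
  then have no: "\<exists>i\<le>n. x \<notin> C i" if "x \<in> convex hull (y ` {..n})" for x using that by blast
  \<comment> \<open>The value of \<open>infdist\<close> at the empty set is 0, so a positive
    distance from a point outside \<open>C i\<close> requires \<open>C i\<close> to be
    nonempty.\<close>
  have ne: "C i \<noteq> {}" if "i \<le> n" for i using cover[of "{i}"] that by auto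
  define l where "l t i = (if i < n then t i / max 1 (\<Sum>j<n. t j)
    else 1 - (\<Sum>j<n. t j) / max 1 (\<Sum>j<n. t j))" for t :: "nat \<Rightarrow> real" and i
  define P where "P t = (\<Sum>i\<le>n. l t i *\<^sub>R y i)" for t
  define d where "d i t = infdist (P t) (C i)" for i t
  define S where "S t = (\<Sum>i\<le>n. d i t)" for t
  have l0: "0 \<le> l t i" if "t \<in> unit_cube n" for t i
    using that by (auto simp: l_def unit_cube_def intro!: divide_nonneg_pos)
  have l1: "(\<Sum>i\<le>n. l t i) = 1" for t
    by (simp add: lessThan_Suc_atMost[symmetric] l_def sum_divide_distrib[symmetric])
  have P: "P t \<in> convex hull (y ` I)" if "t \<in> unit_cube n" "I \<subseteq> {..n}" "\<And>i. i \<in> {..n} - I \<Longrightarrow> l t i = 0"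
    for t I
  proof -
    have "P t = (\<Sum>i\<in>I. l t i *\<^sub>R y i)"
      unfolding P_def using that by (intro sum.mono_neutral_right) auto
    moreover have "(\<Sum>i\<in>I. l t i) = 1"
      using l1[of t] sum.mono_neutral_right[of "{..n}" I "l t"] that by auto
    moreover have "finite I" using that(2) finite_subset by blast
    ultimately show ?thesis
      using l0[OF that(1)] by (simp only:) (intro convex_sum convex_convex_hull hull_inc; simp)
  qed
  have d0: "0 \<le> d i t" for i t by (simp add: d_def infdist_nonneg)
  have Spos: "0 < S t" if t: "t \<in> unit_cube n" for t
  proof -
    obtain i where "i \<le> n" "P t \<notin> C i" using no P[OF t, of "{..n}"] by auto
    then have "0 < d i t"
      using in_closed_iff_infdist_zero[OF closed ne, of i "P t"] d0[of i t] by (simp add: d_def)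
    also have "d i t \<le> S t"
      unfolding S_def using \<open>i \<le> n\<close> d0 by (intro member_le_sum) auto
    finally show ?thesis .
  qed
  have c: "continuous_on (unit_cube n) (\<lambda>t. t j)" for j
    by (rule continuous_on_subset[OF continuous_on_product_coordinates]) simp
  have cl: "continuous_on (unit_cube n) (\<lambda>t. l t i)" for i
  proof -
    have "max 1 (\<Sum>j<n. t j) \<noteq> 0" for t :: "nat \<Rightarrow> real" by linarith
    then show ?thesis
      unfolding l_def
      by (cases "i < n") (auto intro!: continuous_on_divide continuous_on_diff continuous_on_max
          continuous_on_sum continuous_on_const c)
  qed
  have cd: "continuous_on (unit_cube n) (d i)" for i
    unfolding d_def P_def
    by (intro continuous_on_infdist continuous_on_sum continuous_on_scaleR continuous_on_const cl)
  have cS: "continuous_on (unit_cube n) S"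
    unfolding S_def by (intro continuous_on_sum cd)
  have dS: "d i t \<le> S t" if "i \<le> n" for i t
    unfolding S_def using that d0 by (intro member_le_sum) auto
  have "\<exists>t\<in>unit_cube n. \<forall>i<n. d i t / S t = t i"
  proof (rule brouwer_unit_cube[of n "\<lambda>t i. d i t / S t"])
    show "continuous_on (unit_cube n) (\<lambda>t. d i t / S t)" for i
      using Spos by (intro continuous_on_divide cd cS ballI) (metis less_irrefl)
    show "0 \<le> d i t / S t \<and> d i t / S t \<le> 1" if "t \<in> unit_cube n" "i < n" for t i
      using Spos[OF that(1)] d0 dS[of i t] that(2) by simp
  qed
  then obtain t where t: "t \<in> unit_cube n" and fp: "\<And>i. i < n \<Longrightarrow> d i t / S t = t i" by blast
  have part: "(\<Sum>j<n. d j t) + d n t = S t"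
    by (simp add: S_def lessThan_Suc_atMost[symmetric])
  have sum_t: "(\<Sum>j<n. t j) = (\<Sum>j<n. d j t) / S t"
    using fp by (simp add: sum_divide_distrib)
  \<comment> \<open>The fixed point already lies in the simplex, so the retraction leaves it alone
    and its barycentric coordinates are the normalised distances.\<close>
  then have "(\<Sum>j<n. t j) \<le> 1" using part d0[of n t] Spos[OF t] by simp
  then have "l t i = (if i < n then t i else 1 - (\<Sum>j<n. t j))" for i by (simp add: l_def)
  moreover have "1 - (\<Sum>j<n. t j) = d n t / S t"
    using sum_t part Spos[OF t] by (simp add: field_simps)
  ultimately have l: "l t i = d i t / S t" if "i \<le> n" for i
    using fp that by (cases "i = n") auto
  \<comment> \<open>Only vertices whose sets are at positive distance have nonzero weight, yet the
    covering condition puts \<open>P t\<close> into one of exactly these sets.\<close>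
  define I where "I = {i. i \<le> n \<and> d i t \<noteq> 0}"
  have "P t \<in> convex hull (y ` I)" using t l by (intro P) (auto simp: I_def)
  then obtain i where "i \<in> I" "P t \<in> C i" using cover[of I] by (auto simp: I_def)
  then show False
    by (simp add: I_def d_def)
qed

lemma KKM_finite:
  fixes G :: "'a::real_normed_vector \<Rightarrow> 'a set"
  assumes S: "finite S" "S \<noteq> {}"
    and closed: "\<And>y. y \<in> S \<Longrightarrow> closed (G y)"
    and cover: "\<And>T. T \<subseteq> S \<Longrightarrow> convex hull T \<subseteq> (\<Union>y\<in>T. G y)"
  shows "\<exists>x\<in>convex hull S. \<forall>y\<in>S. x \<in> G y"
proof -
  obtain n and y :: "nat \<Rightarrow> 'a" where ny: "S = y ` {i. i < n}"
    using finite_imp_nat_seg_image_inj_on[OF S(1)] by blast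
  then obtain m where "n = Suc m" using S(2) by (cases n) auto
  then have Sm: "S = y ` {..m}" using ny by (simp add: lessThan_def[symmetric] lessThan_Suc_atMost)
  have "\<exists>x\<in>convex hull (y ` {..m}). \<forall>i\<le>m. x \<in> G (y i)"
  proof (rule KKM)
    show "closed (G (y i))" if "i \<le> m" for i using closed that Sm by blast
    show "convex hull (y ` I) \<subseteq> (\<Union>i\<in>I. G (y i))" if "I \<subseteq> {..m}" for I
      using cover[of "y ` I"] that Sm by auto
  qed
  then show ?thesis using Sm by auto
qed

subsection \<open>Self segment-dense sets and set-valued maps\<close>

text \<open>Induction on the vertices. A point of the larger hull is \<open>u a + v b\<close> with
  \<open>b\<close> in the smaller hull. Approximating \<open>b\<close> weakly by points
  \<open>z\<close> of \<open>D\<close> moves it to \<open>u a + v z\<close>, which lies on a segment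
  with both ends in \<open>D\<close>, so segment-density applies there.\<close>

lemma self_segment_dense_in_convex_hull:
  assumes dense: "self_segment_dense_in weak_topology D K"
    and S: "finite S" "S \<subseteq> D"
  shows "convex hull S \<subseteq> weak_topology closure_of (convex hull S \<inter> D)"
  using S
proof (induction S rule: finite_induct)
  case empty
  then show ?case by simp
next
  case (insert a S)
  show ?case
  proof (cases "S = {}")
    case True
    then show ?thesis using insert.prems closure_of_subset[of "{a}" weak_topology] by simp
  next
    case False
    let ?cl = "\<lambda>A. weak_topology closure_of A"
    have "x \<in> ?cl (convex hull (insert a S) \<inter> D)" if x': "x \<in> convex hull (insert a S)" for x
    proof -
      obtain u v b where uv: "0 \<le> u" "0 \<le> v" "u + v = 1" and b: "b \<in> convex hull S"
        and x: "x = u *\<^sub>R a + v *\<^sub>R b"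
        using x' unfolding convex_hull_insert[OF False] by auto
      define h where "h z = u *\<^sub>R a + v *\<^sub>R z" for z
      have "continuous_map weak_topology weak_topology h"
      proof (rule continuous_map_into_weak_topology)
        fix f :: "'a \<Rightarrow>\<^sub>L real"
        have "continuous_map weak_topology euclideanreal (\<lambda>z. u * f a + v * f z)"
          by (intro continuous_map_add continuous_map_real_mult continuous_map_canonical_const
              continuous_map_weak_topology_blinfun)
        then show "continuous_map weak_topology euclideanreal (\<lambda>z. f (h z))"
          by (simp add: h_def blinfun.add_right blinfun.scaleR_right)
      qed
      then have sub: "h ` ?cl (convex hull S \<inter> D) \<subseteq> ?cl (h ` (convex hull S \<inter> D))"
        by (rule continuous_map_image_closure_subset)
      have "b \<in> ?cl (convex hull S \<inter> D)" using insert.IH insert.prems b by blast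
      then have "h b \<in> ?cl (h ` (convex hull S \<inter> D))" using sub by (auto dest: imageI)
      then have "x \<in> ?cl (h ` (convex hull S \<inter> D))" by (simp add: h_def x)
      also have "\<dots> \<subseteq> ?cl (convex hull (insert a S) \<inter> D)"
      proof (rule closure_of_minimal[OF _ closedin_closure_of], rule image_subsetI)
        fix z assume z: "z \<in> convex hull S \<inter> D"
        have "h z \<in> closed_segment a z"
          using uv by (auto simp: h_def closed_segment_def intro!: exI[of _ v])
        also have "closed_segment a z \<subseteq> ?cl (closed_segment a z \<inter> D)"
          using dense z insert.prems unfolding self_segment_dense_in_def by blast
        also have "\<dots> \<subseteq> ?cl (convex hull (insert a S) \<inter> D)"
        proof (rule closure_of_mono)
          have "z \<in> convex hull (insert a S)"
            using z hull_mono[of S "insert a S"] by blast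
          then have "closed_segment a z \<subseteq> convex hull (insert a S)"
            by (intro closed_segment_subset convex_convex_hull) (simp_all add: hull_inc)
          then show "closed_segment a z \<inter> D \<subseteq> convex hull (insert a S) \<inter> D" by blast
        qed
        finally show "h z \<in> ?cl (convex hull (insert a S) \<inter> D)" .
      qed
      finally show ?thesis .
    qed
    then show ?thesis by blast
  qed
qed

text \<open>A negative value persists on a neighbourhood. Semicontinuity at every point makes all
  values nonempty, so the restriction to the domain costs nothing.\<close>

lemma closedin_set_valued_lsc_nonneg:
  assumes "set_valued_lsc_on A T (topspace A)"
  shows "closedin A {x \<in> topspace A. \<forall>u\<in>T x. 0 \<le> u}"
proof -
  have "\<exists>M. openin A M \<and> x \<in> M \<and> M \<subseteq> {x \<in> topspace A. \<exists>u\<in>T x. u < 0}"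
    if x: "x \<in> topspace A" "\<exists>u\<in>T x. u < 0" for x
  proof -
    have lsc: "set_valued_lsc_at A T y" if "y \<in> topspace A" for y
      using assms that unfolding set_valued_lsc_on_def by blast
    have "open {..<0::real}" "T x \<inter> {..<0} \<noteq> {}" using x by auto
    then obtain M where M: "openin A M" "x \<in> M"
      "\<forall>y\<in>M \<inter> set_valued_dom A T. T y \<inter> {..<0} \<noteq> {}"
      using lsc[OF x(1)] unfolding set_valued_lsc_at_def by blast
    have "M \<subseteq> set_valued_dom A T"
      using openin_subset[OF M(1)] lsc unfolding set_valued_lsc_at_def by blast
    with M show ?thesis using openin_subset[OF M(1)] by (intro exI[of _ M]) blast
  qed
  then have "openin A {x \<in> topspace A. \<exists>u\<in>T x. u < 0}"
    by (subst openin_subopen) blast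
  moreover have "topspace A - {x \<in> topspace A. \<forall>u\<in>T x. 0 \<le> u} = {x \<in> topspace A. \<exists>u\<in>T x. u < 0}"
    by (auto simp: not_le)
  ultimately show ?thesis by (auto simp: closedin_def)
qed

lemma set_valued_convex_onD:
  fixes x :: "nat \<Rightarrow> 'a::real_vector"
  assumes "set_valued_convex_on D T"
    and "\<And>i. i \<in> {1..n} \<Longrightarrow> x i \<in> D \<and> 0 \<le> l i \<and> c i \<in> T (x i)"
    and "(\<Sum>i=1..n. l i) = 1" "(\<Sum>i=1..n. l i *\<^sub>R x i) \<in> D"
  shows "(\<Sum>i=1..n. l i * c i) \<in> T (\<Sum>i=1..n. l i *\<^sub>R x i)"
proof -
  have "(\<Sum>i=1..n. l i *o T (x i)) \<subseteq> T (\<Sum>i=1..n. l i *\<^sub>R x i)"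
    using assms(1)[unfolded set_valued_convex_on_def, rule_format, of n x l] assms(2-) by blast
  moreover have "(\<Sum>i=1..n. l i * c i) \<in> (\<Sum>i=1..n. l i *o T (x i))"
    using assms(2) by (auto simp: set_sum_alt elt_set_times_def intro!: exI[of _ "\<lambda>i. l i * c i"])
  ultimately show ?thesis by blast
qed

text \<open>One negative value is chosen at each point of the combination; their weighted sum is
  negative because some weight is positive, and it is a value at \<open>x\<close> because
  \<open>x\<close> lies in \<open>D\<close>.\<close>

lemma set_valued_convex_on_convex_hull_neg:
  assumes conv: "set_valued_convex_on D T"
    and S: "S \<subseteq> D" "\<forall>y\<in>S. \<exists>u\<in>T y. u < 0"
    and x: "x \<in> convex hull S" "x \<in> D"
  shows "\<exists>u\<in>T x. u < 0"
proof -
  obtain n l z where z: "\<forall>i\<in>{1::nat..n}. 0 \<le> l i \<and> z i \<in> S"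
    and l: "(\<Sum>i=1..n. l i) = 1" and xz: "(\<Sum>i=1..n. l i *\<^sub>R z i) = x"
    using x(1) unfolding convex_hull_indexed by blast
  have "\<forall>i\<in>{1..n}. \<exists>u. u \<in> T (z i) \<and> u < 0" using z S(2) by blast
  from bchoice[OF this] obtain c where c: "\<forall>i\<in>{1..n}. c i \<in> T (z i) \<and> c i < 0" ..
  have "(\<Sum>i=1..n. l i * c i) \<in> T (\<Sum>i=1..n. l i *\<^sub>R z i)"
    using z c S(1) l x(2) xz by (intro set_valued_convex_onD[OF conv]) auto
  moreover have "(\<Sum>i=1..n. l i * c i) < (\<Sum>i=1..n. 0)"
  proof (rule sum_strict_mono_ex1)
    show "\<forall>i\<in>{1..n}. l i * c i \<le> 0"
      using z c by (simp add: mult_nonneg_nonpos less_imp_le)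
    have "\<exists>i\<in>{1..n}. l i \<noteq> 0" 
    proof (rule ccontr)
      assume "\<not> ?thesis"
      then have "(\<Sum>i=1..n. l i) = 0" by (intro sum.neutral) blast
      with l show False by simp
    qed
    then obtain i where "i \<in> {1..n}" "0 < l i" using z by (auto simp: order_less_le)
    then show "\<exists>i\<in>{1..n}. l i * c i < 0" using c by (auto intro!: bexI[of _ i] mult_pos_neg)
  qed simp
  ultimately show ?thesis using xz by auto
qed

section \<open>The equilibrium problem on a closed convex set\<close>

theorem theorem4p5:
  fixes K D :: "'a::banach set" and F :: "'a \<Rightarrow> 'a \<Rightarrow> real set"
  assumes "reflexive_space TYPE('a)"
    and "K \<noteq> {}" and "convex K" and "closed K"
    and "D \<subseteq> K" and "self_segment_dense_in weak_topology D K"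
    and "\<forall>y\<in>D. weakly_lsc K (\<lambda>x. F x y) K"
    and "\<forall>x\<in>K. weakly_lsc K (\<lambda>y. F x y) (K - D)"
    and "\<forall>x\<in>K. set_valued_convex_on D (\<lambda>y. F x y)"
    and "\<forall>x\<in>D. \<forall>u\<in>F x x. 0 \<le> u"
    and "\<exists>r>0. (\<exists>x\<in>K. norm x \<le> r) \<and>
           (\<forall>x\<in>K. norm x \<le> r \<longrightarrow> (\<exists>y0\<in>D. norm y0 < r \<and> {0} \<subseteq> F x y0))"
  shows "\<exists>x0\<in>K. \<forall>y\<in>K. \<forall>u\<in>F x0 y. 0 \<le> u"
proof -
  obtain r where ne: "\<exists>x\<in>K. norm x \<le> r"
    and coercive: "\<And>x. x \<in> K \<Longrightarrow> norm x \<le> r \<Longrightarrow> \<exists>y0\<in>D. norm y0 < r \<and> 0 \<in> F x y0"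
    using assms(11) by auto
  define K0 where "K0 = K \<inter> cball 0 r"
  have K0: "convex K0" "closed K0" "bounded K0"
    unfolding K0_def using assms(3,4) by (auto simp: convex_Int closed_Int bounded_Int)
  have compact: "compactin weak_topology K0"
    using assms(1) K0 by (rule compactin_weak_topology_bounded_convex)
  define G where "G y = {x \<in> K0. \<forall>u\<in>F x y. 0 \<le> u}" for y
  have closedG: "closedin weak_topology (G y)" if y: "y \<in> D" for y
  proof -
    have "closedin (subtopology weak_topology K) {x \<in> K. \<forall>u\<in>F x y. 0 \<le> u}"
      using closedin_set_valued_lsc_nonneg[of "subtopology weak_topology K" "\<lambda>x. F x y"]
        assms(7) y by simp
    \<comment> \<open>Relative closedness lifts from \<open>K\<close> to the whole space because
      \<open>K\<close> is itself weakly closed by Mazur's theorem.\<close>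
    then have "closedin weak_topology {x \<in> K. \<forall>u\<in>F x y. 0 \<le> u}"
      using closedin_weak_topology_convex[OF assms(3,4)] closedin_closed_subtopology by blast
    then have "closedin weak_topology ({x \<in> K. \<forall>u\<in>F x y. 0 \<le> u} \<inter> K0)"
      using closedin_weak_topology_convex[OF K0(1,2)] by (rule closedin_Int)
    moreover have "{x \<in> K. \<forall>u\<in>F x y. 0 \<le> u} \<inter> K0 = G y" by (auto simp: G_def K0_def)
    ultimately show ?thesis by simp
  qed
  have cover: "convex hull T \<subseteq> (\<Union>y\<in>T. G y)" if T: "finite T" "T \<subseteq> D \<inter> K0" for T
  proof -
    have "convex hull T \<inter> D \<subseteq> (\<Union>y\<in>T. G y)"
    proof
      fix x assume x: "x \<in> convex hull T \<inter> D"
      have "x \<in> K0" using x T(2) K0(1) hull_minimal[of T K0 convex] by blast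
      show "x \<in> (\<Union>y\<in>T. G y)"
      proof (rule ccontr)
        assume "x \<notin> (\<Union>y\<in>T. G y)"
        then have "\<forall>y\<in>T. \<exists>u\<in>F x y. u < 0" using \<open>x \<in> K0\<close> by (auto simp: G_def not_le)
        then have "\<exists>u\<in>F x x. u < 0"
          using set_valued_convex_on_convex_hull_neg[of D "F x" T x] assms(9) T(2) x \<open>x \<in> K0\<close>
          by (auto simp: K0_def)
        then show False using assms(10) x by force
      qed
    qed
    moreover have "closedin weak_topology (\<Union>y\<in>T. G y)"
      using T closedG by (intro closedin_Union) auto
    ultimately have "weak_topology closure_of (convex hull T \<inter> D) \<subseteq> (\<Union>y\<in>T. G y)"
      by (rule closure_of_minimal)
    then show ?thesis
      using self_segment_dense_in_convex_hull[OF assms(6) T(1)] T(2) by blast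
  qed
  have fip: "K0 \<inter> \<Inter>\<F> \<noteq> {}" if Fin: "finite \<F>" "\<F> \<subseteq> G ` (D \<inter> K0)" for \<F>
  proof -
    obtain S where S: "S \<subseteq> D \<inter> K0" "finite S" "\<F> = G ` S"
      using finite_subset_image[OF Fin] by blast
    show ?thesis
    proof (cases "S = {}")
      \<comment> \<open>The empty family is where the ball has to meet \<open>K\<close>.\<close>
      case True
      then show ?thesis using ne S(3) by (auto simp: K0_def)
    next
      case False
      have "\<exists>x\<in>convex hull S. \<forall>y\<in>S. x \<in> G y"
      proof (rule KKM_finite[OF S(2) False])
        show "closed (G y)" if "y \<in> S" for y
          using closedG closedin_weak_topology_imp_closed that S(1) by blast
        show "convex hull T \<subseteq> (\<Union>y\<in>T. G y)" if "T \<subseteq> S" for T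
          using cover that S(1,2) finite_subset[OF that] by blast
      qed
      then show ?thesis using False S(3) by (auto simp: G_def)
    qed
  qed
  have "K0 \<inter> \<Inter>(G ` (D \<inter> K0)) \<noteq> {}"
  proof (rule compact[unfolded compactin_fip, THEN conjunct2, THEN spec, THEN mp], intro conjI)
    show "\<forall>C\<in>G ` (D \<inter> K0). closedin weak_topology C" using closedG by simp
    show "\<forall>\<F>. finite \<F> \<and> \<F> \<subseteq> G ` (D \<inter> K0) \<longrightarrow> K0 \<inter> \<Inter>\<F> \<noteq> {}" using fip by simp
  qed
  then obtain x0 where x0: "x0 \<in> K0" "\<And>y. y \<in> D \<inter> K0 \<Longrightarrow> x0 \<in> G y" by blast
  have x0K: "x0 \<in> K" "norm x0 \<le> r" using x0(1) by (auto simp: K0_def)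
  have onD: "0 \<le> u" if y: "y \<in> D" and u: "u \<in> F x0 y" for y u
  proof -
    obtain y0 where y0: "y0 \<in> D" "norm y0 < r" "0 \<in> F x0 y0"
      using coercive[OF x0K] by blast
    show ?thesis
    proof (cases "y = y0")
      case True
      then have "y \<in> D \<inter> K0" using y0 assms(5) by (auto simp: K0_def)
      from x0(2)[OF this] show ?thesis using u by (auto simp: G_def)
    next
      case False
      then obtain f :: "'a \<Rightarrow>\<^sub>L real" and d where d: "0 < d" "f y0 + d \<le> f y"
        using separating_functional_closed_point[of "{y}" y0] by auto
      define s where "s = f y - f y0"
      have s: "0 < s" using d by (simp add: s_def)
      have ny: "0 < norm (y - y0)" using False by simp
      \<comment> \<open>For parameters up to \<open>e\<close> the segment stays in the ball;
        \<open>e\<close> is positive because \<open>norm y0 < r\<close> is strict.\<close>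
      define e where "e = min 1 ((r - norm y0) / norm (y - y0))"
      have e: "0 < e" "e \<le> 1" using y0(2) ny by (auto simp: e_def)
      have small: "norm (y0 + t *\<^sub>R (y - y0)) \<le> r" if "0 \<le> t" "t \<le> e" for t
      proof -
        have "t * norm (y - y0) \<le> r - norm y0"
          using that(2) ny by (simp add: e_def pos_le_divide_eq)
        then show ?thesis using norm_triangle_ineq[of y0 "t *\<^sub>R (y - y0)"] that(1) by simp
      qed
      have fseg: "f (y0 + t *\<^sub>R (y - y0)) = f y0 + t * s" for t
        by (simp add: s_def blinfun.add_right blinfun.scaleR_right blinfun.diff_right)
      \<comment> \<open>Along the segment, \<open>f\<close> is affine with slope \<open>s\<close>,
        so this weakly open slab cuts out exactly the parameters strictly between 0 and
        \<open>e\<close>. It contains the point with parameter \<open>e / 2\<close>, hence also a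
        point of \<open>D\<close> on the segment.\<close>
      let ?W = "blinfun_apply f -` {f y0<..<f y0 + e * s}"
      let ?p = "y0 + (e / 2) *\<^sub>R (y - y0)"
      have "openin weak_topology ?W" by (rule openin_weak_topology_vimage) simp
      moreover have "?p \<in> ?W" using e s by (simp add: fseg)
      moreover have "?p \<in> closed_segment y0 y"
        unfolding closed_segment_def using e
        by (auto intro!: exI[of _ "e / 2"] simp: algebra_simps)
      then have "?p \<in> weak_topology closure_of (closed_segment y0 y \<inter> D)"
        using assms(6) y0(1) y unfolding self_segment_dense_in_def by blast
      ultimately obtain z where z: "z \<in> closed_segment y0 y" "z \<in> D" "z \<in> ?W"
        unfolding in_closure_of by blast
      obtain t where t: "0 \<le> t" "t \<le> 1" "z = (1 - t) *\<^sub>R y0 + t *\<^sub>R y"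
        using z(1) unfolding closed_segment_def by blast
      have zt: "z = y0 + t *\<^sub>R (y - y0)" using t(3) by (simp add: algebra_simps)
      have "0 < t * s" "t * s < e * s" using z(3) fseg[of t] by (auto simp: zt)
      then have te: "0 < t" "t < e" using s by (auto simp: zero_less_mult_iff)
      then have "z \<in> D \<inter> K0" using z(2) assms(5) small[of t] by (auto simp: K0_def zt)
      from x0(2)[OF this] have zpos: "\<forall>w\<in>F x0 z. 0 \<le> w" by (auto simp: G_def)
      \<comment> \<open>Two-point convexity at \<open>z\<close>, with the value 0 at
        \<open>y0\<close> and \<open>u\<close> at \<open>y\<close>, makes \<open>t * u\<close> a
        value of \<open>F x0 z\<close>; dividing by \<open>t > 0\<close> keeps the sign.\<close>
      define x l c where "x i = (if i = 1 then y0 else y)" and "l i = (if i = 1 then 1 - t else t)"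
        and "c i = (if i = 1 then 0 else u)" for i :: nat
      have "(\<Sum>i=1..2. l i * c i) \<in> F x0 (\<Sum>i=1..2. l i *\<^sub>R x i)"
        using assms(9) x0K(1) y y0 u t z(2)
        by (intro set_valued_convex_onD[of D]) (auto simp: numeral_2_eq_2 x_def l_def c_def)
      then have "t * u \<in> F x0 z" by (simp add: numeral_2_eq_2 x_def l_def c_def t(3))
      with zpos te(1) show ?thesis by (auto simp: zero_le_mult_iff)
    qed
  qed
  have "0 \<le> u" if y: "y \<in> K" "y \<notin> D" and u: "u \<in> F x0 y" for y u
  proof (rule ccontr)
    assume "\<not> 0 \<le> u"
    then have "open {..<0::real}" "F x0 y \<inter> {..<0} \<noteq> {}" using u by auto
    moreover have "set_valued_lsc_at (subtopology weak_topology K) (F x0) y"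
      using assms(8) x0K(1) y unfolding set_valued_lsc_on_def by blast
    ultimately obtain M where M: "openin (subtopology weak_topology K) M" "y \<in> M"
      "\<forall>z\<in>M \<inter> set_valued_dom (subtopology weak_topology K) (F x0). F x0 z \<inter> {..<0} \<noteq> {}"
      unfolding set_valued_lsc_at_def by blast
    obtain W where W: "openin weak_topology W" "M = W \<inter> K"
      using M(1) unfolding openin_subtopology by blast
    have "y \<in> weak_topology closure_of D"
      using assms(6) y(1) unfolding self_segment_dense_in_def by blast
    then obtain z where z: "z \<in> D" "z \<in> W" using W M(2) unfolding in_closure_of by blast
    \<comment> \<open>Semicontinuity in the second argument speaks only of points with nonempty
      values. That \<open>z\<close> is one follows from semicontinuity in the first argument, which
      puts \<open>x0\<close> in the domain of the map for \<open>z\<close>.\<close>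
    have "F x0 z \<noteq> {}"
      using assms(7) z(1) x0K(1)
      unfolding set_valued_lsc_on_def set_valued_lsc_at_def set_valued_dom_def by blast
    then have "z \<in> M \<inter> set_valued_dom (subtopology weak_topology K) (F x0)"
      using z assms(5) W(2) by (auto simp: set_valued_dom_def)
    then obtain w where "w \<in> F x0 z" "w < 0" using M(3) by blast
    with onD[OF z(1)] show False by force
  qed
  with onD x0K(1) show ?thesis by blast
qed

end
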